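(* Let $k\in\mathbb{N}$ and $z\in\mathbb{C}$ with $-1<\operatorname{Re}(z)<k-1$. The function $w(x)=H_z^{(k)}(x)$, $x\ge0$, satisfies the linear differential equation \[ x^2\frac{d^{2k+2}w}{dx^{2k+2}}+(2z+k+3)x\frac{d^{2k+1}w}{dx^{2k+1}}+(z+1)(z+k+1)\frac{d^{2k}w}{dx^{2k}}+(-1)^kk^2w=0. \]
   Context: $H_z^{(k)}(x):=\int_0^\infty t^{z-k}\cos(xt)\cos(t^{-k})\,dt$.
   Formalization: The differential equation is asserted for x > 0 rather than x ≥ 0, because the derivatives of w up to order 2k+2 do not all exist at x = 0 (for k = 1, z = -1/2, w(x) - w(0) behaves like a nonzero multiple of x^(1/2)); for x ≥ 0 convergence of the integral is proved. *)

theory Defs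
  imports "HOL-Analysis.Analysis"
begin

definition H_integrand :: "nat \<Rightarrow> complex \<Rightarrow> real \<Rightarrow> real \<Rightarrow> complex" where
  "H_integrand k z x t =
     complex_of_real t powr (z - of_nat k) * of_real (cos (x * t)) * of_real (cos (1 / t ^ k))"

text \<open>
  For \<open>-1 < Re z < k - 1\<close> the integral defining \<open>H\<close> converges only conditionally at \<open>0\<close>, so it
  cannot be a Lebesgue integral. The gauge (Henstock-Kurzweil) integral used here
  extends the improper Riemann integral.
\<close>

definition H :: "nat \<Rightarrow> complex \<Rightarrow> real \<Rightarrow> complex" where
  "H k z x = integral {0<..} (H_integrand k z x)"

text \<open>
  \<^const>\<open>deriv\<close> does not apply to complex-valued functions of a real variable, hence the
  iteration of \<^const>\<open>vector_derivative\<close>.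
\<close>

definition nth_deriv :: "nat \<Rightarrow> (real \<Rightarrow> complex) \<Rightarrow> real \<Rightarrow> complex" where
  "nth_deriv n f = ((\<lambda>g x. vector_derivative g (at x)) ^^ n) f"

end

theory Submission
  imports Defs "HOL-Complex_Analysis.Complex_Analysis" "HOL-Real_Asymp.Real_Asymp"
begin

text \<open>
  Write \<open>cos (x t)\<close> as the mean of \<open>exp (- c x t)\<close> over \<open>c = \<i>, - \<i>\<close> and put
  \<open>f t = t powr (z - k) * cos (1 / t ^ k)\<close>, which is holomorphic for \<open>Re t > 0\<close>. The integral of
  \<open>f t * exp (- \<zeta> t)\<close> along the positive axis converges at infinity too slowly to be
  differentiated under the integral sign, but turning the path at \<open>t = 1\<close> into the ray \<open>1 - c s\<close>
  gives exponential decay and hence a function of \<open>\<zeta>\<close> that is holomorphic near \<open>\<zeta> = c x\<close>,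
  \<open>x > 0\<close>, with the same value at \<open>c x\<close> by Cauchy's theorem. At \<open>0\<close> one integration by parts
  makes the convergence locally uniform in \<open>\<zeta>\<close>. For paths that are cut off at both ends, the
  differential operator applied to \<open>f t * exp (- \<zeta> t)\<close> is an exact derivative in \<open>t\<close>; the
  boundary terms vanish in the limit, and derivatives pass to locally uniform limits of
  holomorphic functions.
\<close>

section \<open>Differentiating integrals along segments in the parameter\<close>

lemma contour_integral_exp_has_field_derivative:
  assumes "continuous_on (closed_segment a b) f"
  shows "((\<lambda>\<zeta>. contour_integral (linepath a b) (\<lambda>t. f t * exp (- \<zeta> * t)))
    has_field_derivative contour_integral (linepath a b) (\<lambda>t. - t * f t * exp (- \<zeta> * t))) (at \<zeta>)"
proof -
  have f: "continuous_on {0..1} (\<lambda>s. f (linepath a b s))"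
    by (rule continuous_on_compose2[OF assms]) (auto intro!: continuous_intros simp: linepath_in_path)
  have f2: "continuous_on (UNIV \<times> cbox 0 1) (\<lambda>p. f (linepath a b (snd p)))"
    by (rule continuous_on_compose2[OF f]) (auto intro!: continuous_intros)
  have l2: "continuous_on (UNIV \<times> cbox 0 1) (\<lambda>p. linepath a b (snd p))"
    by (rule continuous_on_compose2[OF continuous_on_linepath[of UNIV]]) (auto intro!: continuous_intros)
  have "((\<lambda>\<zeta>. integral (cbox 0 1) (\<lambda>s. f (linepath a b s) * exp (- \<zeta> * linepath a b s) * (b - a)))
    has_field_derivative
    integral (cbox 0 1) (\<lambda>s. - linepath a b s * f (linepath a b s) * exp (- \<zeta> * linepath a b s) * (b - a)))
    (at \<zeta> within UNIV)"
  proof (rule leibniz_rule_field_derivative)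
    show "(\<lambda>s. f (linepath a b s) * exp (- x * linepath a b s) * (b - a)) integrable_on cbox 0 1" for x
      using f by (auto intro!: integrable_continuous_real continuous_intros)
    show "continuous_on (UNIV \<times> cbox 0 1) (\<lambda>(x, t). - linepath a b t * f (linepath a b t) *
        exp (- x * linepath a b t) * (b - a))"
      unfolding case_prod_beta using f2 l2 by (intro continuous_intros)
  qed (auto intro!: derivative_eq_intros)
  thus ?thesis
    by (simp add: contour_integral_integral)
qed

text \<open>Each differentiation brings down a factor \<open>- t\<close>. It is absorbed into the
  weight, which stays continuous on the segment, so the first-order formula applies again.\<close>

lemma higher_deriv_contour_integral_exp:
  assumes "continuous_on (closed_segment a b) f"
  shows "(deriv ^^ n) (\<lambda>\<zeta>. contour_integral (linepath a b) (\<lambda>t. f t * exp (- \<zeta> * t))) =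
    (\<lambda>\<zeta>. contour_integral (linepath a b) (\<lambda>t. (- t) ^ n * f t * exp (- \<zeta> * t)))"
proof (induction n)
  case (Suc n)
  have "continuous_on (closed_segment a b) (\<lambda>t. (- t) ^ n * f t)"
    by (intro continuous_intros assms)
  from contour_integral_exp_has_field_derivative[OF this, THEN DERIV_imp_deriv] show ?case
    by (simp only: funpow.simps o_apply Suc.IH power_Suc mult.assoc)
qed simp

text \<open>Both exponentials in Euler's formula have norm at most \<open>exp (norm z)\<close>. The
  bound serves on the rotated ray, where \<open>1 / t ^ k\<close> is not real and the sine is not
  bounded by 1.\<close>

lemma norm_sin_le_exp:
  fixes z :: complex
  shows "norm (sin z) \<le> exp (norm z)"
proof -
  have "norm (exp (\<i> * z) - inverse (exp (\<i> * z))) \<le> exp (norm z) + exp (norm z)"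
    unfolding exp_minus[symmetric]
    by (rule norm_triangle_le_diff, rule add_mono)
      (metis norm_exp norm_minus_cancel norm_mult norm_ii mult_1)+
  thus ?thesis
    unfolding sin_exp_eq by (simp add: norm_divide norm_mult exp_minus)
qed

section \<open>The integrand and its primitives in the right half-plane\<close>

text \<open>The lower bound on \<open>Re z\<close> makes \<open>t powr Re z\<close> integrable at 0;
  the upper bound makes \<open>t powr (Re z - k)\<close> integrable at infinity.\<close>

locale oscillatory_integral =
  fixes k :: nat and z :: complex
  assumes Re_z_gt: "- 1 < Re z" and Re_z_lt: "Re z < real k - 1"
begin

lemma k_pos: "k > 0"
  using Re_z_gt Re_z_lt by linarith

definition osc :: "complex \<Rightarrow> complex" where
  "osc t = t powr (z - of_nat k) * cos (1 / t ^ k)"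

definition kern :: "complex \<Rightarrow> complex \<Rightarrow> complex" where
  "kern \<zeta> t = osc t * exp (- \<zeta> * t)"

lemma Re_pos_nonpos_Reals: "Re t > 0 \<Longrightarrow> t \<notin> \<real>\<^sub>\<le>\<^sub>0"
  by (auto simp: complex_nonpos_Reals_iff)

lemma osc_holomorphic: "osc holomorphic_on {t. Re t > 0}"
  unfolding osc_def by (intro holomorphic_intros) (auto simp: Re_pos_nonpos_Reals)

lemma kern_holomorphic: "kern \<zeta> holomorphic_on {t. Re t > 0}"
  unfolding kern_def by (intro holomorphic_intros osc_holomorphic)

text \<open>The choice is made separately for every \<zeta>, so the additive constant depends on
  \<zeta> in an uncontrolled way. Only differences of two values with the same \<zeta> carry
  meaning; Cauchy's theorem is built in, since they do not depend on a path.\<close>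

definition prim :: "complex \<Rightarrow> complex \<Rightarrow> complex" where
  "prim \<zeta> = (SOME g. \<forall>t. Re t > 0 \<longrightarrow> (g has_field_derivative kern \<zeta> t) (at t))"

lemma prim_has_field_derivative:
  assumes "Re t > 0"
  shows "(prim \<zeta> has_field_derivative kern \<zeta> t) (at t)"
proof -
  let ?S = "{t::complex. Re t > 0}"
  have "open ?S" "convex ?S"
    by (auto simp: open_halfspace_Re_gt convex_halfspace_Re_gt)
  then obtain g where "\<And>t. t \<in> ?S \<Longrightarrow> (g has_field_derivative kern \<zeta> t) (at t within ?S)"
    using holomorphic_convex_primitive'[OF _ _ kern_holomorphic] by metis
  hence "\<exists>g. \<forall>t. Re t > 0 \<longrightarrow> (g has_field_derivative kern \<zeta> t) (at t)"
    using at_within_open[OF _ \<open>open ?S\<close>] by (metis mem_Collect_eq)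
  thus ?thesis
    using assms someI_ex[of "\<lambda>g. \<forall>t. Re t > 0 \<longrightarrow> (g has_field_derivative kern \<zeta> t) (at t)"]
    unfolding prim_def by blast
qed

lemma closed_segment_Re_pos:
  assumes "Re a > 0" "Re b > 0"
  shows "closed_segment a b \<subseteq> {t. Re t > 0}"
  by (rule closed_segment_subset) (use assms in \<open>auto simp: convex_halfspace_Re_gt\<close>)

lemma has_contour_integral_primitive_Re_pos:
  assumes "Re a > 0" "Re b > 0" "\<And>t. Re t > 0 \<Longrightarrow> (g has_field_derivative f t) (at t)"
  shows "(f has_contour_integral (g b - g a)) (linepath a b)"
  using contour_integral_primitive[of "{t. Re t > 0}" g f "linepath a b"] assms
    closed_segment_Re_pos[OF assms(1,2)]
  by (auto intro: has_field_derivative_at_within)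

lemma kern_has_contour_integral:
  assumes "Re a > 0" "Re b > 0"
  shows "(kern \<zeta> has_contour_integral (prim \<zeta> b - prim \<zeta> a)) (linepath a b)"
  by (rule has_contour_integral_primitive_Re_pos[OF assms prim_has_field_derivative])

text \<open>In the difference the arbitrary constant cancels, and what remains is the integral of
  \<open>kern \<zeta>\<close> along the segment, to which the parameter formulas apply.\<close>

lemma higher_deriv_prim_diff:
  assumes "Re a > 0" "Re b > 0"
  shows "(deriv ^^ n) (\<lambda>\<zeta>. prim \<zeta> b - prim \<zeta> a) =
    (\<lambda>\<zeta>. contour_integral (linepath a b) (\<lambda>t. (- t) ^ n * kern \<zeta> t))"
    and "(\<lambda>\<zeta>. prim \<zeta> b - prim \<zeta> a) holomorphic_on A"
proof -
  have c: "continuous_on (closed_segment a b) osc"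
    using holomorphic_on_imp_continuous_on[OF osc_holomorphic] closed_segment_Re_pos[OF assms]
    by (rule continuous_on_subset)
  have eq: "(\<lambda>\<zeta>. prim \<zeta> b - prim \<zeta> a) =
      (\<lambda>\<zeta>. contour_integral (linepath a b) (\<lambda>t. osc t * exp (- \<zeta> * t)))"
    using kern_has_contour_integral[OF assms, THEN contour_integral_unique, symmetric]
    by (simp add: kern_def[abs_def])
  show "(deriv ^^ n) (\<lambda>\<zeta>. prim \<zeta> b - prim \<zeta> a) =
    (\<lambda>\<zeta>. contour_integral (linepath a b) (\<lambda>t. (- t) ^ n * kern \<zeta> t))"
    unfolding eq higher_deriv_contour_integral_exp[OF c] kern_def by (simp add: mult.assoc)
  show "(\<lambda>\<zeta>. prim \<zeta> b - prim \<zeta> a) holomorphic_on A"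
    unfolding eq holomorphic_on_def field_differentiable_def
    using contour_integral_exp_has_field_derivative[OF c] has_field_derivative_at_within by blast
qed

section \<open>The differential operator as an exact derivative\<close>

text \<open>
  With \<open>\<theta> = t d/dt\<close>, the function \<open>g t = cos (1 / t ^ k)\<close> satisfies
  \<open>\<theta>\<^sup>2 g + k \<theta> g = - k\<^sup>2 t ^ (- 2 k) g\<close>, and \<open>\<zeta> d/d\<zeta>\<close> acts on \<open>exp (- \<zeta> t)\<close> as \<open>\<theta>\<close>;
  two integrations by parts produce the following boundary term.
\<close>

definition boundary :: "complex \<Rightarrow> complex \<Rightarrow> complex" where
  "boundary \<zeta> t = exp (- \<zeta> * t) * (t powr (z + of_nat k + 1) * (z + 1 - \<zeta> * t) * cos (1 / t ^ k)
     - of_nat k * t powr (z + 1) * sin (1 / t ^ k))"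

text \<open>The factor \<open>(- t) ^ n\<close> stands for \<open>n\<close> derivatives in \<zeta>.
  On differentiating \<open>boundary\<close> the sine terms cancel; the derivative of the remaining
  sine supplies the term with \<open>of_nat k ^ 2\<close>.\<close>

lemma boundary_has_field_derivative:
  assumes "Re t > 0"
  shows "(boundary \<zeta> has_field_derivative
    (\<zeta>\<^sup>2 * (- t) ^ (2 * k + 2) + (2 * z + of_nat k + 3) * \<zeta> * (- t) ^ (2 * k + 1)
      + (z + 1) * (z + of_nat k + 1) * (- t) ^ (2 * k) + of_nat k ^ 2) * kern \<zeta> t) (at t)"
proof -
  have t0: "t \<noteq> 0" using assms by auto
  \<comment> \<open>In terms of \<open>t\<close>, \<open>p\<close>, \<open>q\<close>,
    \<open>C\<close>, \<open>D\<close> and \<open>E\<close> the claim becomes a rational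
    identity.\<close>
  define p where "p = t powr (z - of_nat k)"
  define q where "q = t ^ k"
  define C where "C = cos (1 / q)"
  define D where "D = sin (1 / q)"
  define E where "E = exp (- \<zeta> * t)"
  have q0: "q \<noteq> 0" using t0 by (simp add: q_def)
  have p1: "t powr (z + of_nat k + 1) = p * q\<^sup>2 * t" "t powr (z + of_nat k) = p * q\<^sup>2"
     "t powr (z + 1) = p * q * t" "t powr z = p * q"
  proof -
    have *: "t powr (z - of_nat k + of_nat n) = p * t ^ n" for n
      using t0 by (simp add: powr_add p_def)
    show "t powr (z + of_nat k + 1) = p * q\<^sup>2 * t"
      using *[of "2 * k + 1"] by (simp add: q_def algebra_simps power_mult power2_eq_square power_mult_distrib flip: power_add)
    show "t powr (z + of_nat k) = p * q\<^sup>2"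
      using *[of "2 * k"] by (simp add: q_def algebra_simps power_mult power2_eq_square flip: power_add)
    show "t powr (z + 1) = p * q * t"
      using *[of "k + 1"] by (simp add: q_def algebra_simps)
    show "t powr z = p * q"
      using *[of k] by (simp add: q_def)
  qed
  have pow: "(- t) ^ (2 * k + 2) = q\<^sup>2 * t\<^sup>2" "(- t) ^ (2 * k + 1) = - q\<^sup>2 * t" "(- t) ^ (2 * k) = q\<^sup>2"
    by (simp_all add: q_def power_mult power_add power2_eq_square flip: power_mult_distrib)
  have inv: "((\<lambda>t. 1 / t ^ k) has_field_derivative - of_nat k / (q * t)) (at t)"
    using k_pos t0 by (auto intro!: derivative_eq_intros simp: q_def field_simps power_eq_if[of t k])
  have Cd: "((\<lambda>t. cos (1 / t ^ k)) has_field_derivative of_nat k / (q * t) * D) (at t)"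
    using DERIV_fun_cos[OF inv] by (simp add: D_def q_def mult.commute)
  have Dd: "((\<lambda>t. sin (1 / t ^ k)) has_field_derivative - of_nat k / (q * t) * C) (at t)"
    using DERIV_fun_sin[OF inv] by (simp add: C_def q_def mult.commute)
  have Ed: "((\<lambda>t. exp (- \<zeta> * t)) has_field_derivative - \<zeta> * E) (at t)"
    unfolding E_def by (auto intro!: derivative_eq_intros)
  have Pd: "((\<lambda>t. t powr (z + of_nat k + 1)) has_field_derivative (z + of_nat k + 1) * (p * q\<^sup>2)) (at t)"
    using has_field_derivative_powr[OF Re_pos_nonpos_Reals[OF assms], of "z + of_nat k + 1"] by (simp add: p1)
  have Qd: "((\<lambda>t. t powr (z + 1)) has_field_derivative (z + 1) * (p * q)) (at t)"
    using has_field_derivative_powr[OF Re_pos_nonpos_Reals[OF assms], of "z + 1"] by (simp add: p1)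
  have Ld: "((\<lambda>t. z + 1 - \<zeta> * t) has_field_derivative - \<zeta>) (at t)"
    by (auto intro!: derivative_eq_intros)
  note d = DERIV_mult[OF Ed DERIV_diff[OF DERIV_mult[OF DERIV_mult[OF Pd Ld] Cd]
     DERIV_mult[OF DERIV_cmult[OF Qd, of "of_nat k"] Dd]]]
  show ?thesis
    unfolding boundary_def
    apply (rule DERIV_cong[OF d])
    unfolding pow kern_def osc_def
    apply (simp add: p1 flip: p_def q_def C_def D_def E_def)
    using t0 q0 apply (simp add: field_simps power2_eq_square E_def)
    done
qed

section \<open>Uniform convergence at the origin\<close>

lemma norm_exp_minus_mult_le:
  assumes "norm \<zeta> \<le> M" "0 \<le> s" "s \<le> 1"
  shows "norm (exp (- \<zeta> * complex_of_real s)) \<le> exp M"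
proof -
  have "norm (- \<zeta> * complex_of_real s) \<le> M * 1"
    unfolding norm_mult using assms order_trans[OF norm_ge_zero assms(1)] by (intro mult_mono) auto
  thus ?thesis
    using norm_exp[of "- \<zeta> * complex_of_real s"] by (smt (verit) exp_le_cancel_iff)
qed

lemma norm_sin_cos_real:
  "norm (sin (1 / complex_of_real s ^ k)) \<le> 1" "norm (cos (1 / complex_of_real s ^ k)) \<le> 1"
proof -
  have "1 / complex_of_real s ^ k = of_real (1 / s ^ k)" by simp
  thus "norm (sin (1 / complex_of_real s ^ k)) \<le> 1" "norm (cos (1 / complex_of_real s ^ k)) \<le> 1"
    by (simp_all only: sin_of_real cos_of_real norm_of_real abs_sin_le_one abs_cos_le_one)
qed

text \<open>The available size bound \<open>t powr (Re z - k)\<close> is not integrable at 0, so the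
  oscillation has to be used: one integration by parts replaces the exponent by \<open>Re z\<close>,
  which exceeds -1. The constant depends on \<zeta> only through \<open>M\<close>.\<close>

lemma prim_diff_near_0:
  "\<exists>C. \<forall>\<zeta> e d. norm \<zeta> \<le> M \<longrightarrow> 0 < e \<longrightarrow> e \<le> d \<longrightarrow> d \<le> 1 \<longrightarrow>
    norm (prim \<zeta> (complex_of_real d) - prim \<zeta> (complex_of_real e)) \<le> C * d powr (Re z + 1)"
proof (intro exI allI impI)
  fix \<zeta> :: complex and e d :: real
  assume \<zeta>: "norm \<zeta> \<le> M" and e: "0 < e" and ed: "e \<le> d" and d: "d \<le> 1"
  \<comment> \<open>As \<open>sin (1 / t ^ k)\<close> has derivative
    \<open>- k * cos (1 / t ^ k) / t ^ (k + 1)\<close>, \<open>\<Psi>\<close> is the boundary term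
    of the integration by parts and \<open>R\<close> the remaining integrand.\<close>
  define \<Psi> where "\<Psi> t = - (1 / of_nat k) * t powr (z + 1) * exp (- \<zeta> * t) * sin (1 / t ^ k)" for t
  define R where "R t = (1 / of_nat k) * t powr z * (z + 1 - \<zeta> * t) * exp (- \<zeta> * t) * sin (1 / t ^ k)" for t
  define A where "A = (norm z + 1 + M) * exp M"
  have M: "M \<ge> 0" using \<zeta> norm_ge_zero order_trans by blast
  have A: "A \<ge> 0" unfolding A_def using M by auto
  have \<Psi>: "norm (\<Psi> (of_real s)) \<le> exp M * d powr (Re z + 1)" if s: "0 < s" "s \<le> d" for s
  proof -
    have "norm (\<Psi> (of_real s)) \<le> 1 * (s powr (Re z + 1)) * exp M * 1"
      unfolding \<Psi>_def norm_mult
      using norm_exp_minus_mult_le[OF \<zeta>, of s] s d norm_sin_cos_real[of s] k_pos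
      by (intro mult_mono) (auto simp: norm_powr_real_powr norm_divide)
    also have "\<dots> \<le> 1 * (d powr (Re z + 1)) * exp M * 1"
      using s Re_z_gt by (intro mult_mono powr_mono2) auto
    finally show ?thesis by (simp add: mult.commute)
  qed
  have \<Psi>_deriv: "((\<lambda>t. prim \<zeta> t - \<Psi> t) has_field_derivative R t) (at t)" if t: "Re t > 0" for t
  proof -
    have t0: "t \<noteq> 0" using t by auto
    have inv: "((\<lambda>t. 1 / t ^ k) has_field_derivative - of_nat k / (t ^ k * t)) (at t)"
      using k_pos t0 by (auto intro!: derivative_eq_intros simp: field_simps power_eq_if[of t k])
    have Pd: "((\<lambda>t. t powr (z + 1)) has_field_derivative (z + 1) * t powr z) (at t)"
      using has_field_derivative_powr[OF Re_pos_nonpos_Reals[OF t], of "z + 1"] by simp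
    have Ed: "((\<lambda>t. exp (- \<zeta> * t)) has_field_derivative - \<zeta> * exp (- \<zeta> * t)) (at t)"
      by (auto intro!: derivative_eq_intros)
    have p: "t powr (z + 1) = t powr z * t" "t powr (1 + z) = t powr z * t" "t powr z = t powr (z - of_nat k) * t ^ k"
      using t0 by (simp_all add: powr_add powr_diff)
    show ?thesis
      unfolding \<Psi>_def
      apply (rule DERIV_cong[OF DERIV_diff[OF prim_has_field_derivative[OF t]
            DERIV_mult[OF DERIV_mult[OF DERIV_cmult[OF Pd] Ed] DERIV_fun_sin[OF inv]]]])
      using t0 k_pos by (simp add: R_def kern_def osc_def p field_simps)
  qed
  have R: "norm (R (of_real s)) \<le> A * s powr Re z" if s: "0 < s" "s \<le> 1" for s
  proof -
    have "norm (z + 1 - \<zeta> * of_real s) \<le> norm z + 1 + M * 1"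
      by (intro order_trans[OF norm_triangle_ineq4] add_mono order_trans[OF norm_triangle_ineq])
         (use s mult_mono[OF \<zeta> s(2)] M in \<open>auto simp: norm_mult\<close>)
    hence "norm (R (of_real s)) \<le> 1 * s powr Re z * (norm z + 1 + M) * exp M * 1"
      unfolding R_def norm_mult
      using norm_exp_minus_mult_le[OF \<zeta>, of s] s norm_sin_cos_real[of s] k_pos M
      by (intro mult_mono) (auto simp: norm_powr_real_powr norm_divide)
    thus ?thesis by (simp add: A_def mult_ac)
  qed
  \<comment> \<open>By the mean value inequality the increment is at most that of a primitive of the
    bound \<open>A * s powr Re z\<close>. The inequality needs a nondegenerate interval, hence the
    case \<open>e = d\<close>.\<close>
  have "norm ((prim \<zeta> d - \<Psi> d) - (prim \<zeta> e - \<Psi> e)) \<le> A / (Re z + 1) * d powr (Re z + 1) - A / (Re z + 1) * e powr (Re z + 1)"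
  proof (cases "e = d")
    case False
    have D: "((\<lambda>s. prim \<zeta> (of_real s) - \<Psi> (of_real s)) has_vector_derivative R (of_real s)) (at s)" if "s > 0" for s
      using has_vector_derivative_real_field[OF \<Psi>_deriv[of "of_real s"]] that by simp
    have D': "((\<lambda>s. A / (Re z + 1) * s powr (Re z + 1)) has_vector_derivative A * s powr Re z) (at s)" if "s > 0" for s
      unfolding has_real_derivative_iff_has_vector_derivative[symmetric]
      using that Re_z_gt by (auto intro!: derivative_eq_intros)
    show ?thesis
    proof (rule differentiable_bound_general[OF _ _ _ D D'])
      show "continuous_on {e..d} (\<lambda>s. prim \<zeta> (of_real s) - \<Psi> (of_real s))"
        using e by (intro continuous_at_imp_continuous_on ballI)
          (auto intro!: has_vector_derivative_continuous[OF D])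
      show "continuous_on {e..d} (\<lambda>s. A / (Re z + 1) * s powr (Re z + 1))"
        using e by (intro continuous_at_imp_continuous_on ballI has_vector_derivative_continuous[OF D']) auto
    qed (use e ed d False R in auto)
  qed auto
  also have "\<dots> \<le> A / (Re z + 1) * d powr (Re z + 1)"
    using A Re_z_gt by simp
  finally have "norm ((prim \<zeta> d - \<Psi> d) - (prim \<zeta> e - \<Psi> e)) \<le> A / (Re z + 1) * d powr (Re z + 1)" .
  moreover have "norm (prim \<zeta> d - prim \<zeta> e) \<le>
      norm ((prim \<zeta> d - \<Psi> d) - (prim \<zeta> e - \<Psi> e)) + norm (\<Psi> d) + norm (\<Psi> e)"
  proof -
    have "prim \<zeta> d - prim \<zeta> e = ((prim \<zeta> d - \<Psi> d) - (prim \<zeta> e - \<Psi> e)) + \<Psi> d - \<Psi> e" by simp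
    thus ?thesis
      using norm_triangle_ineq4[of "((prim \<zeta> d - \<Psi> d) - (prim \<zeta> e - \<Psi> e)) + \<Psi> d" "\<Psi> e"]
        norm_triangle_ineq[of "(prim \<zeta> d - \<Psi> d) - (prim \<zeta> e - \<Psi> e)" "\<Psi> d"] by simp
  qed
  \<comment> \<open>The first summand of the constant comes from \<open>R\<close>, the second from
    \<open>\<Psi>\<close> at the two ends.\<close>
  ultimately show "norm (prim \<zeta> d - prim \<zeta> e) \<le>
      ((norm z + 1 + M) * exp M / (Re z + 1) + 2 * exp M) * d powr (Re z + 1)"
    using \<Psi>[of d] \<Psi>[of e] e ed by (simp add: A_def algebra_simps)
qed

section \<open>Exponential decay along the rotated ray\<close>

lemma norm_powr_le:
  "norm (t powr w) \<le> exp (\<bar>Im w\<bar> * pi) * norm t powr Re w"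
proof -
  have "\<bar>Arg t\<bar> \<le> pi"
    using Arg_bounded[of t] by auto
  hence "\<bar>Im w\<bar> * \<bar>Arg t\<bar> \<le> \<bar>Im w\<bar> * pi"
    by (intro mult_left_mono) auto
  hence "- Im w * Arg t \<le> \<bar>Im w\<bar> * pi"
    using abs_ge_minus_self[of "Im w * Arg t"] by (simp add: abs_mult)
  thus ?thesis
    unfolding norm_powr_complex by (subst mult.commute) (intro mult_right_mono, auto)
qed

lemma exp_inverse_power_le:
  assumes "norm (t::complex) \<ge> 1"
  shows "exp (norm (1 / t ^ k)) \<le> exp 1"
  using one_le_power[OF assms, of k] by (simp add: norm_divide norm_power)

text \<open>Outside the open unit disc \<open>1 / t ^ k\<close> has norm at most 1, so the cosine is
  bounded and only the power remains.\<close>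

lemma norm_osc_le:
  assumes "norm t \<ge> 1"
  shows "norm (osc t) \<le> exp (\<bar>Im z\<bar> * pi + 1) * norm t powr (Re z - k)"
proof -
  have "norm (cos (1 / t ^ k)) \<le> exp 1"
    using norm_cos_le exp_inverse_power_le[OF assms] order_trans by blast
  hence "norm (osc t) \<le> (exp (\<bar>Im (z - of_nat k)\<bar> * pi) * norm t powr Re (z - of_nat k)) * exp 1"
    unfolding osc_def norm_mult by (intro mult_mono norm_powr_le) auto
  thus ?thesis by (simp add: exp_add mult_ac)
qed

text \<open>The ray runs along the vertical line through 1. It therefore stays in the half-plane of
  \<open>prim\<close> and in the region of \<open>norm_osc_le\<close>.\<close>

lemma ray_bounds:
  assumes "c = \<i> \<or> c = - \<i>"
  shows "Re (1 - c * of_real s) = 1" "norm (1 - c * of_real s) \<ge> 1"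
proof -
  show "Re (1 - c * of_real s) = 1" using assms by auto
  thus "norm (1 - c * of_real s) \<ge> 1" using complex_Re_le_cmod[of "1 - c * of_real s"] by linarith
qed

text \<open>The exponent is \<open>- \<zeta> + \<zeta> * c * s\<close>. At
  \<open>\<zeta> = c * x\<close> the product \<open>\<zeta> * c\<close> equals \<open>- x\<close>,
  so the points with \<open>x > 0\<close> lie in the open half-plane
  \<open>Re (\<zeta> * c) < 0\<close>, where the exponential decays.\<close>

lemma norm_exp_ray_le:
  assumes "norm \<zeta> \<le> M" "Re (\<zeta> * c) \<le> - r" "0 \<le> s"
  shows "norm (exp (- \<zeta> * (1 - c * complex_of_real s))) \<le> exp M * exp (- r * s)"
proof -
  have "Re (- \<zeta> * (1 - c * complex_of_real s)) = - Re \<zeta> + Re (\<zeta> * c) * s"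
    by (simp add: algebra_simps)
  also have "- Re \<zeta> \<le> M"
    using assms(1) abs_Re_le_cmod[of \<zeta>] by linarith
  also have "Re (\<zeta> * c) * s \<le> - r * s"
    using assms by (intro mult_right_mono) auto
  finally have "Re (- \<zeta> * (1 - c * complex_of_real s)) \<le> M + - r * s" by simp
  thus ?thesis unfolding norm_exp_eq_Re exp_add[symmetric] by simp
qed

text \<open>On the ray the power in \<open>norm_osc_le\<close> is at most 1, its exponent being
  negative. The integrand is thus dominated by a multiple of \<open>exp (- r * s)\<close>, and the
  mean value inequality integrates this bound.\<close>

lemma prim_diff_ray:
  assumes c: "c = \<i> \<or> c = - \<i>" and r: "r > 0"
  shows "\<exists>C. \<forall>\<zeta> m n. norm \<zeta> \<le> M \<longrightarrow> Re (\<zeta> * c) \<le> - r \<longrightarrow> 0 \<le> m \<longrightarrow> m < n \<longrightarrow>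
    norm (prim \<zeta> (1 - c * complex_of_real n) - prim \<zeta> (1 - c * complex_of_real m)) \<le> C * exp (- r * m)"
proof (intro exI allI impI)
  fix \<zeta> :: complex and m n :: real
  assume \<zeta>: "norm \<zeta> \<le> M" "Re (\<zeta> * c) \<le> - r" and mn: "0 \<le> m" "m < n"
  define B where "B = exp (\<bar>Im z\<bar> * pi + 1) * exp M"
  have B: "B \<ge> 0" by (simp add: B_def)
  have D: "((\<lambda>s. prim \<zeta> (1 - c * of_real s)) has_vector_derivative - c * kern \<zeta> (1 - c * of_real s)) (at s)" for s
  proof -
    have "((\<lambda>s. prim \<zeta> (1 - c * s)) has_field_derivative kern \<zeta> (1 - c * of_real s) * - c) (at (of_real s))"
      by (rule DERIV_chain2[OF prim_has_field_derivative])
         (use ray_bounds(1)[OF c, of s] in \<open>auto intro!: derivative_eq_intros\<close>)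
    from has_vector_derivative_real_field[OF this] show ?thesis by (simp add: mult.commute)
  qed
  have D': "((\<lambda>s. - B / r * exp (- r * s)) has_vector_derivative B * exp (- r * s)) (at s)" for s
    unfolding has_real_derivative_iff_has_vector_derivative[symmetric]
    using r by (auto intro!: derivative_eq_intros)
  have "norm (prim \<zeta> (1 - c * complex_of_real n) - prim \<zeta> (1 - c * complex_of_real m)) \<le>
      - B / r * exp (- r * n) - - B / r * exp (- r * m)"
  proof (rule differentiable_bound_general[OF mn(2) _ _ D D'])
    show "continuous_on {m..n} (\<lambda>s. prim \<zeta> (1 - c * of_real s))"
      by (intro continuous_at_imp_continuous_on ballI has_vector_derivative_continuous[OF D])
    show "continuous_on {m..n} (\<lambda>s. - B / r * exp (- r * s))"
      by (intro continuous_at_imp_continuous_on ballI has_vector_derivative_continuous[OF D'])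
    fix s assume s: "m < s" "s < n"
    let ?t = "1 - c * complex_of_real s"
    have "norm (osc ?t) \<le> exp (\<bar>Im z\<bar> * pi + 1) * norm ?t powr (Re z - k)"
      by (rule norm_osc_le[OF ray_bounds(2)[OF c]])
    also have "\<dots> \<le> exp (\<bar>Im z\<bar> * pi + 1) * 1"
      using powr_mono[of "Re z - k" 0 "norm ?t"] ray_bounds(2)[OF c, of s] Re_z_lt
      by (intro mult_left_mono) (auto split: if_splits)
    finally have "norm (osc ?t) \<le> exp (\<bar>Im z\<bar> * pi + 1)" by simp
    hence "norm (kern \<zeta> ?t) \<le> exp (\<bar>Im z\<bar> * pi + 1) * (exp M * exp (- r * s))"
      unfolding kern_def norm_mult using s mn by (intro mult_mono norm_exp_ray_le \<zeta>) auto
    thus "norm (- c * kern \<zeta> ?t) \<le> B * exp (- r * s)"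
      using c by (auto simp: norm_mult B_def mult_ac)
  qed
  also have "\<dots> \<le> B / r * exp (- r * m)"
    using B r by simp
  finally show "norm (prim \<zeta> (1 - c * complex_of_real n) - prim \<zeta> (1 - c * complex_of_real m)) \<le>
     (exp (\<bar>Im z\<bar> * pi + 1) * exp M / r) * exp (- r * m)"
    by (simp add: B_def)
qed

section \<open>Vanishing of the boundary terms\<close>

lemma tendsto_boundary_0: "(\<lambda>n. boundary \<zeta> (complex_of_real (1 / real n))) \<longlonglongrightarrow> 0"
proof (rule Lim_null_comparison)
  define K where "K = exp (norm \<zeta>) * ((norm z + 1 + norm \<zeta>) + k)"
  have *: "norm (boundary \<zeta> (complex_of_real s)) \<le> K * s powr (Re z + 1)" if s: "0 < s" "s \<le> 1" for s
  proof -
    have l: "norm (z + 1 - \<zeta> * of_real s) \<le> norm z + 1 + norm \<zeta>"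
      by (intro order_trans[OF norm_triangle_ineq4] add_mono order_trans[OF norm_triangle_ineq])
         (use s in \<open>auto simp: norm_mult intro: mult_left_le\<close>)
    have "norm (of_real s powr (z + of_nat k + 1) * (z + 1 - \<zeta> * of_real s) * cos (1 / of_real s ^ k)) \<le>
        s powr (Re z + 1) * (norm z + 1 + norm \<zeta>) * 1"
      unfolding norm_mult using s l norm_sin_cos_real[of s]
      by (intro mult_mono) (auto simp: norm_powr_real_powr intro!: powr_mono')
    moreover have "norm (of_nat k * of_real s powr (z + 1) * sin (1 / of_real s ^ k)) \<le>
        real k * s powr (Re z + 1) * 1"
      unfolding norm_mult using s norm_sin_cos_real[of s]
      by (intro mult_mono) (auto simp: norm_powr_real_powr)
    ultimately have "norm (boundary \<zeta> (complex_of_real s)) \<le> exp (norm \<zeta>) *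
        (s powr (Re z + 1) * (norm z + 1 + norm \<zeta>) * 1 + real k * s powr (Re z + 1) * 1)"
      unfolding boundary_def using s norm_exp_minus_mult_le[of \<zeta> "norm \<zeta>" s]
      by (subst norm_mult, intro mult_mono order_trans[OF norm_triangle_ineq4] add_mono) auto
    thus ?thesis by (simp add: K_def algebra_simps)
  qed
  \<comment> \<open>The index 0 is excluded because \<open>1 / real 0\<close> is 0.\<close>
  show "\<forall>\<^sub>F n in sequentially. norm (boundary \<zeta> (complex_of_real (1 / real n))) \<le> K * (1 / real n) powr (Re z + 1)"
    using eventually_gt_at_top[of 0] by eventually_elim (rule *, auto)
  define a where "a = Re z + 1"
  have "a > 0" using Re_z_gt by (simp add: a_def)
  thus "(\<lambda>n. K * (1 / real n) powr (Re z + 1)) \<longlonglongrightarrow> 0"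
    unfolding a_def[symmetric] by real_asymp
qed

text \<open>The powers of \<open>t\<close> and the linear factor grow at most polynomially along the
  ray, while the exponential decays at the rate \<open>- Re (\<zeta> * c)\<close>.\<close>

lemma tendsto_boundary_ray:
  assumes c: "c = \<i> \<or> c = - \<i>" and \<zeta>: "Re (\<zeta> * c) < 0"
  shows "(\<lambda>n. boundary \<zeta> (1 - c * complex_of_real (real n))) \<longlonglongrightarrow> 0"
proof (rule Lim_null_comparison)
  define r M p A where "r = - Re (\<zeta> * c)" and "M = norm \<zeta>" and "p = Re z + k + 1"
    and "A = norm z + 1 + k"
  define B where "B = exp M * exp (\<bar>Im z\<bar> * pi) * exp 1"
  show "\<forall>\<^sub>F n in sequentially. norm (boundary \<zeta> (1 - c * complex_of_real (real n))) \<le>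
     B * (exp (- r * real n) * (1 + real n) powr p * (A + M * (1 + real n)))"
  proof (intro always_eventually allI)
    fix n
    let ?s = "real n"
    let ?t = "1 - c * complex_of_real (real n)"
    have T: "norm ?t \<ge> 1" "norm ?t \<le> 1 + ?s"
      using ray_bounds(2)[OF c, of ?s] norm_triangle_ineq4[of 1 "c * complex_of_real ?s"] c
      by (auto simp: norm_mult)
    \<comment> \<open>Here \<open>p\<close> is the larger of the two real exponents in
      \<open>boundary\<close>, so one bound covers both.\<close>
    have pw: "norm (?t powr w) \<le> exp (\<bar>Im z\<bar> * pi) * (1 + ?s) powr p"
      if "Im w = Im z" "0 \<le> Re w" "Re w \<le> p" for w
    proof -
      have "norm (?t powr w) \<le> exp (\<bar>Im z\<bar> * pi) * norm ?t powr Re w"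
        using norm_powr_le[of ?t w] that by simp
      also have "norm ?t powr Re w \<le> (1 + ?s) powr Re w"
        using T that by (intro powr_mono2) auto
      also have "(1 + ?s) powr Re w \<le> (1 + ?s) powr p"
        using that by (intro powr_mono) auto
      finally show ?thesis by simp
    qed
    have l: "norm (z + 1 - \<zeta> * ?t) \<le> norm z + 1 + M * (1 + ?s)"
      unfolding M_def
      by (intro order_trans[OF norm_triangle_ineq4] add_mono order_trans[OF norm_triangle_ineq])
         (use T in \<open>auto simp: norm_mult intro: mult_left_mono\<close>)
    have cos: "norm (cos (1 / ?t ^ k)) \<le> exp 1" and sin: "norm (sin (1 / ?t ^ k)) \<le> exp 1"
      using norm_cos_le norm_sin_le_exp exp_inverse_power_le[OF T(1)] order_trans by blast+
    have "norm (?t powr (z + of_nat k + 1) * (z + 1 - \<zeta> * ?t) * cos (1 / ?t ^ k)) \<le>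
        (exp (\<bar>Im z\<bar> * pi) * (1 + ?s) powr p) * (norm z + 1 + M * (1 + ?s)) * exp 1"
      unfolding norm_mult using Re_z_gt
      by (intro mult_mono pw l cos) (auto simp: p_def M_def)
    moreover have "norm (of_nat k * ?t powr (z + 1) * sin (1 / ?t ^ k)) \<le>
        real k * (exp (\<bar>Im z\<bar> * pi) * (1 + ?s) powr p) * exp 1"
      unfolding norm_mult using Re_z_gt
      by (intro mult_mono pw sin) (auto simp: p_def)
    ultimately have "norm (boundary \<zeta> ?t) \<le> (exp M * exp (- r * ?s)) *
       ((exp (\<bar>Im z\<bar> * pi) * (1 + ?s) powr p) * (norm z + 1 + M * (1 + ?s)) * exp 1 +
        real k * (exp (\<bar>Im z\<bar> * pi) * (1 + ?s) powr p) * exp 1)"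
      unfolding boundary_def
      by (subst norm_mult, intro mult_mono order_trans[OF norm_triangle_ineq4] add_mono norm_exp_ray_le)
         (auto simp: M_def r_def)
    thus "norm (boundary \<zeta> ?t) \<le> B * (exp (- r * ?s) * (1 + ?s) powr p * (A + M * (1 + ?s)))"
      by (simp add: B_def A_def algebra_simps)
  qed
  have "r > 0" using \<zeta> by (simp add: r_def)
  thus "(\<lambda>n. B * (exp (- r * real n) * (1 + real n) powr p * (A + M * (1 + real n)))) \<longlonglongrightarrow> 0"
    by real_asymp
qed

section \<open>The integral over the rotated path and its differential equation\<close>

text \<open>For \<open>n > 0\<close> this is the integral of \<open>kern \<zeta>\<close> from
  \<open>1 / n\<close> to 1 and on along the ray to \<open>1 - c * n\<close>. For
  \<open>n = 0\<close> the lower end point is 0, outside the half-plane.\<close>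

definition approx :: "complex \<Rightarrow> nat \<Rightarrow> complex \<Rightarrow> complex" where
  "approx c n \<zeta> = prim \<zeta> (1 - c * of_real (real n)) - prim \<zeta> (of_real (1 / real n))"

text \<open>The value of \<open>lim\<close> is significant only for
  \<open>Re (\<zeta> * c) < 0\<close>, where convergence is established.\<close>

definition rotated :: "complex \<Rightarrow> complex \<Rightarrow> complex" where
  "rotated c \<zeta> = lim (\<lambda>n. approx c n \<zeta>)"

lemma approx_holomorphic:
  assumes "c = \<i> \<or> c = - \<i>" "n > 0"
  shows "approx c n holomorphic_on A"
  unfolding approx_def
  by (rule higher_deriv_prim_diff(2)) (use assms ray_bounds(1)[of c "real n"] in auto)

text \<open>One contour integral is evaluated twice: by differentiation under the integral sign, and
  by \<open>boundary\<close> as a primitive of the integrand.\<close>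

lemma approx_ode:
  assumes c: "c = \<i> \<or> c = - \<i>" and n: "n > 0"
  shows "\<zeta>\<^sup>2 * (deriv ^^ (2 * k + 2)) (approx c n) \<zeta>
    + (2 * z + of_nat k + 3) * \<zeta> * (deriv ^^ (2 * k + 1)) (approx c n) \<zeta>
    + (z + 1) * (z + of_nat k + 1) * (deriv ^^ (2 * k)) (approx c n) \<zeta>
    + of_nat k ^ 2 * approx c n \<zeta> =
    boundary \<zeta> (1 - c * of_real (real n)) - boundary \<zeta> (of_real (1 / real n))"
    (is "?l = ?r")
proof -
  let ?b = "1 - c * complex_of_real (real n)" and ?a = "complex_of_real (1 / real n)"
  have ab: "Re ?a > 0" "Re ?b > 0"
    using n ray_bounds(1)[OF c, of "real n"] by auto
  have D: "(deriv ^^ j) (approx c n) \<zeta> = contour_integral (linepath ?a ?b) (\<lambda>t. (- t) ^ j * kern \<zeta> t)" for j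
    unfolding approx_def by (subst higher_deriv_prim_diff(1)[OF ab]) simp
  have "continuous_on (closed_segment ?a ?b) (kern \<zeta>)"
    using holomorphic_on_imp_continuous_on[OF kern_holomorphic] closed_segment_Re_pos[OF ab]
    by (rule continuous_on_subset)
  hence I: "((\<lambda>t. (- t) ^ j * kern \<zeta> t) has_contour_integral (deriv ^^ j) (approx c n) \<zeta>) (linepath ?a ?b)" for j
    unfolding D
    by (intro has_contour_integral_integral contour_integrable_continuous_linepath continuous_intros)
  have I0: "(kern \<zeta> has_contour_integral approx c n \<zeta>) (linepath ?a ?b)"
    using I[of 0] by simp
  have "((\<lambda>t. \<zeta>\<^sup>2 * ((- t) ^ (2 * k + 2) * kern \<zeta> t)
      + (2 * z + of_nat k + 3) * \<zeta> * ((- t) ^ (2 * k + 1) * kern \<zeta> t)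
      + (z + 1) * (z + of_nat k + 1) * ((- t) ^ (2 * k) * kern \<zeta> t) + of_nat k ^ 2 * kern \<zeta> t)
     has_contour_integral ?l) (linepath ?a ?b)"
    by (intro has_contour_integral_add has_contour_integral_lmul I I0)
  moreover have "((\<lambda>t. \<zeta>\<^sup>2 * ((- t) ^ (2 * k + 2) * kern \<zeta> t)
      + (2 * z + of_nat k + 3) * \<zeta> * ((- t) ^ (2 * k + 1) * kern \<zeta> t)
      + (z + 1) * (z + of_nat k + 1) * ((- t) ^ (2 * k) * kern \<zeta> t) + of_nat k ^ 2 * kern \<zeta> t)
     has_contour_integral ?r) (linepath ?a ?b)"
    using has_contour_integral_primitive_Re_pos[OF ab boundary_has_field_derivative, of \<zeta>]
    by (simp only: ring_distribs mult.assoc)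
  ultimately show ?thesis
    by (rule has_contour_integral_unique)
qed

text \<open>On a bounded set at positive distance from the line \<open>Re (\<zeta> * c) = 0\<close>,
  the pieces added at the two ends have bounds independent of \<zeta>, so the sequence is uniformly
  Cauchy.\<close>

lemma uniform_limit_approx:
  assumes c: "c = \<i> \<or> c = - \<i>" and r: "r > 0"
  shows "uniform_limit {\<zeta>. norm \<zeta> < M \<and> Re (\<zeta> * c) < - r} (approx c) (rotated c) sequentially"
proof -
  obtain C where C: "\<And>\<zeta> e d. \<lbrakk>norm \<zeta> \<le> M; 0 < e; e \<le> d; d \<le> 1\<rbrakk> \<Longrightarrow>
    norm (prim \<zeta> (complex_of_real d) - prim \<zeta> (complex_of_real e)) \<le> C * d powr (Re z + 1)"
    using prim_diff_near_0[of M] by blast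
  obtain B where B: "\<And>\<zeta> m n. \<lbrakk>norm \<zeta> \<le> M; Re (\<zeta> * c) \<le> - r; 0 \<le> m; m < n\<rbrakk> \<Longrightarrow>
    norm (prim \<zeta> (1 - c * complex_of_real n) - prim \<zeta> (1 - c * complex_of_real m)) \<le> B * exp (- r * m)"
    using prim_diff_ray[OF c r, of M] by blast
  define E where "E m = B * exp (- r * real m) + C * (1 / real m) powr (Re z + 1)" for m
  have le: "norm (approx c n \<zeta> - approx c m \<zeta>) \<le> E m"
    if "norm \<zeta> < M" "Re (\<zeta> * c) < - r" "m > 0" "m < n" for \<zeta> m n
  proof -
    \<comment> \<open>At the origin the order of \<open>m\<close> and \<open>n\<close> is reversed,
      since \<open>1 / n < 1 / m\<close>.\<close>
    have "approx c n \<zeta> - approx c m \<zeta> =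
        (prim \<zeta> (1 - c * complex_of_real n) - prim \<zeta> (1 - c * complex_of_real m)) +
        (prim \<zeta> (complex_of_real (1 / real m)) - prim \<zeta> (complex_of_real (1 / real n)))"
      by (simp add: approx_def)
    also have "norm \<dots> \<le> E m"
      unfolding E_def using that
      by (intro order_trans[OF norm_triangle_ineq] add_mono B C) (auto simp: frac_le)
    finally show ?thesis .
  qed
  define a where "a = Re z + 1"
  have "a > 0" using Re_z_gt by (simp add: a_def)
  hence "E \<longlonglongrightarrow> 0"
    unfolding E_def a_def[symmetric] using r by real_asymp
  have "uniformly_Cauchy_on {\<zeta>. norm \<zeta> < M \<and> Re (\<zeta> * c) < - r} (approx c)"
  proof (rule uniformly_Cauchy_onI')
    fix e :: real assume "e > 0"
    with \<open>E \<longlonglongrightarrow> 0\<close> have "eventually (\<lambda>m. E m < e) sequentially"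
      by (rule order_tendstoD)
    then obtain N where N: "\<And>m. m \<ge> N \<Longrightarrow> E m < e"
      unfolding eventually_sequentially by blast
    show "\<exists>N. \<forall>\<zeta>\<in>{\<zeta>. norm \<zeta> < M \<and> Re (\<zeta> * c) < - r}. \<forall>m\<ge>N. \<forall>n>m. dist (approx c m \<zeta>) (approx c n \<zeta>) < e"
    proof (intro exI[of _ "max 1 N"] ballI allI impI)
      fix \<zeta> m n assume "\<zeta> \<in> {\<zeta>. norm \<zeta> < M \<and> Re (\<zeta> * c) < - r}" "m \<ge> max 1 N" "n > m"
      thus "dist (approx c m \<zeta>) (approx c n \<zeta>) < e"
        using le[of \<zeta> m n] N[of m] by (auto simp: dist_norm norm_minus_commute)
    qed
  qed
  thus ?thesis
    unfolding rotated_def[abs_def] uniformly_convergent_uniform_limit_iff[symmetric]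
    by (rule Cauchy_uniformly_convergent)
qed

text \<open>By Weierstrass, all derivatives of holomorphic functions converge along with a locally
  uniform limit.\<close>

lemma higher_deriv_approx_tendsto:
  assumes c: "c = \<i> \<or> c = - \<i>" and \<zeta>: "Re (\<zeta> * c) < 0"
  shows "(\<lambda>n. (deriv ^^ j) (approx c n) \<zeta>) \<longlonglongrightarrow> (deriv ^^ j) (rotated c) \<zeta>"
proof (rule higher_deriv_complex_uniform_limit)
  \<comment> \<open>Halving keeps \<zeta> strictly inside the region of uniform convergence.\<close>
  define r where "r = - Re (\<zeta> * c) / 2"
  have r: "r > 0" "Re (\<zeta> * c) < - r"
    using \<zeta> unfolding r_def mem_Collect_eq by linarith+
  let ?A = "{\<xi>. norm \<xi> < norm \<zeta> + 1 \<and> Re (\<xi> * c) < - r}"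
  show "uniform_limit ?A (approx c) (rotated c) sequentially"
    by (rule uniform_limit_approx[OF c r(1)])
  show "\<forall>\<^sub>F n in sequentially. approx c n holomorphic_on ?A"
    using eventually_gt_at_top[of 0] by eventually_elim (rule approx_holomorphic[OF c])
  show "open ?A"
    by (intro open_Collect_conj open_Collect_less continuous_intros)
  show "\<zeta> \<in> ?A" using r by simp
qed auto

lemma rotated_holomorphic:
  assumes c: "c = \<i> \<or> c = - \<i>"
  shows "rotated c holomorphic_on {\<zeta>. Re (\<zeta> * c) < 0}"
proof (rule holomorphic_uniform_sequence)
  let ?S = "{\<zeta>. Re (\<zeta> * c) < 0}"
  show S: "open ?S" by (intro open_Collect_less continuous_intros)
  \<comment> \<open>The shift avoids the degenerate index 0.\<close>
  show "approx c (Suc n) holomorphic_on ?S" for n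
    by (rule approx_holomorphic[OF c]) simp
  fix \<zeta> assume \<zeta>: "\<zeta> \<in> ?S"
  define r where "r = - Re (\<zeta> * c) / 2"
  have r: "r > 0" "Re (\<zeta> * c) < - r"
    using \<zeta> unfolding r_def mem_Collect_eq by linarith+
  let ?A = "{\<xi>. norm \<xi> < norm \<zeta> + 1 \<and> Re (\<xi> * c) < - r}"
  have "open ?A" by (intro open_Collect_conj open_Collect_less continuous_intros)
  moreover have "\<zeta> \<in> ?A" using r by simp
  ultimately obtain d where d: "d > 0" "cball \<zeta> d \<subseteq> ?A"
    using open_contains_cball by blast
  have "uniform_limit (cball \<zeta> d) (approx c) (rotated c) sequentially"
    by (rule uniform_limit_on_subset[OF uniform_limit_approx[OF c r(1)] d(2)])
  hence "uniform_limit (cball \<zeta> d) (\<lambda>n. approx c (Suc n)) (rotated c) sequentially"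
    by (rule filterlim_compose[OF _ filterlim_Suc])
  thus "\<exists>d>0. cball \<zeta> d \<subseteq> ?S \<and> uniform_limit (cball \<zeta> d) (\<lambda>n. approx c (Suc n)) (rotated c) sequentially"
    using d r by (intro exI[of _ d]) auto
qed

text \<open>The left side of \<open>approx_ode\<close> converges term by term, and both boundary
  terms on its right side tend to 0.\<close>

lemma rotated_ode:
  assumes c: "c = \<i> \<or> c = - \<i>" and \<zeta>: "Re (\<zeta> * c) < 0"
  shows "\<zeta>\<^sup>2 * (deriv ^^ (2 * k + 2)) (rotated c) \<zeta>
    + (2 * z + of_nat k + 3) * \<zeta> * (deriv ^^ (2 * k + 1)) (rotated c) \<zeta>
    + (z + 1) * (z + of_nat k + 1) * (deriv ^^ (2 * k)) (rotated c) \<zeta>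
    + of_nat k ^ 2 * rotated c \<zeta> = 0" (is "?R = 0")
proof (rule LIMSEQ_unique)
  note lim = higher_deriv_approx_tendsto[OF c \<zeta>]
  show "(\<lambda>n. \<zeta>\<^sup>2 * (deriv ^^ (2 * k + 2)) (approx c n) \<zeta>
    + (2 * z + of_nat k + 3) * \<zeta> * (deriv ^^ (2 * k + 1)) (approx c n) \<zeta>
    + (z + 1) * (z + of_nat k + 1) * (deriv ^^ (2 * k)) (approx c n) \<zeta>
    + of_nat k ^ 2 * approx c n \<zeta>) \<longlonglongrightarrow> ?R" (is "?f \<longlonglongrightarrow> _")
    by (intro tendsto_intros lim lim[of 0, simplified])
  have "(\<lambda>n. boundary \<zeta> (1 - c * of_real (real n)) - boundary \<zeta> (of_real (1 / real n))) \<longlonglongrightarrow> 0"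
    using tendsto_diff[OF tendsto_boundary_ray[OF c \<zeta>] tendsto_boundary_0] by simp
  moreover have "\<forall>\<^sub>F n in sequentially. boundary \<zeta> (1 - c * of_real (real n)) - boundary \<zeta> (of_real (1 / real n)) = ?f n"
    using eventually_gt_at_top[of 0] by eventually_elim (rule approx_ode[OF c, symmetric])
  ultimately show "?f \<longlonglongrightarrow> 0"
    by (rule Lim_transform_eventually)
qed


section \<open>Convergence of the integral over the positive axis\<close>

lemma prim_has_vector_derivative:
  assumes "t > 0"
  shows "((\<lambda>t. prim \<zeta> (complex_of_real t)) has_vector_derivative kern \<zeta> (complex_of_real t)) (at t within S)"
  by (rule has_vector_derivative_real_field, rule prim_has_field_derivative) (use assms in simp)

text \<open>By \<open>prim_diff_near_0\<close> the primitive has a limit at 0. The fundamental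
  theorem for the gauge integral asks for continuity on the closed interval and a derivative only in
  its interior, so no absolute convergence is required.\<close>

lemma kern_has_integral_near_0:
  obtains l where "((\<lambda>t. kern \<zeta> (complex_of_real t)) has_integral (prim \<zeta> 1 - l)) {0..1}"
    and "(\<lambda>n. prim \<zeta> (complex_of_real (1 / real (Suc n)))) \<longlonglongrightarrow> l"
proof -
  obtain C where C: "\<And>e d. \<lbrakk>0 < e; e \<le> d; d \<le> 1\<rbrakk> \<Longrightarrow>
    norm (prim \<zeta> (complex_of_real d) - prim \<zeta> (complex_of_real e)) \<le> C * d powr (Re z + 1)"
    using prim_diff_near_0[of "norm \<zeta>"] by blast
  define a where "a = Re z + 1"
  have a: "a > 0" using Re_z_gt by (simp add: a_def)
  define u where "u n = prim \<zeta> (complex_of_real (1 / real (Suc n)))" for n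
  have "Cauchy u"
  proof (rule CauchyI')
    fix e :: real assume "e > 0"
    moreover have "(\<lambda>m. C * (1 / real (Suc m)) powr a) \<longlonglongrightarrow> 0"
      using a by real_asymp
    ultimately have "eventually (\<lambda>m. C * (1 / real (Suc m)) powr a < e) sequentially"
      by (rule order_tendstoD(2)[rotated])
    then obtain N where N: "\<And>m. m \<ge> N \<Longrightarrow> C * (1 / real (Suc m)) powr a < e"
      unfolding eventually_sequentially by blast
    show "\<exists>M. \<forall>m\<ge>M. \<forall>n>m. dist (u m) (u n) < e"
    proof (intro exI[of _ N] allI impI)
      fix m n assume "m \<ge> N" "n > m"
      hence "norm (u m - u n) \<le> C * (1 / real (Suc m)) powr a"
        unfolding u_def a_def by (intro C) (auto simp: field_simps)
      also have "\<dots> < e" by (rule N) fact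
      finally show "dist (u m) (u n) < e" by (simp add: dist_norm)
    qed
  qed
  then obtain l where l: "u \<longlonglongrightarrow> l"
    using Cauchy_convergent convergent_def by blast
  \<comment> \<open>Letting the inner end point tend to 0 turns the Cauchy estimate into a rate of
    convergence to \<open>l\<close>.\<close>
  have bound: "norm (prim \<zeta> (complex_of_real d) - l) \<le> C * d powr a" if "0 < d" "d \<le> 1" for d
  proof (rule tendsto_upperbound)
    show "(\<lambda>n. norm (prim \<zeta> (complex_of_real d) - u n)) \<longlonglongrightarrow> norm (prim \<zeta> (complex_of_real d) - l)"
      by (intro tendsto_intros l)
    have "(\<lambda>n. 1 / real (Suc n)) \<longlonglongrightarrow> 0" by real_asymp
    hence "\<forall>\<^sub>F n in sequentially. 1 / real (Suc n) < d"
      using that(1) by (rule order_tendstoD)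
    thus "\<forall>\<^sub>F n in sequentially. norm (prim \<zeta> (complex_of_real d) - u n) \<le> C * d powr a"
    proof eventually_elim
      case (elim n)
      thus ?case unfolding u_def a_def using that by (intro C) auto
    qed
  qed auto
  \<comment> \<open>The value of \<open>prim \<zeta>\<close> at 0 is unspecified and is replaced by
    the limit.\<close>
  define q where "q t = (if t = 0 then l else prim \<zeta> (complex_of_real t))" for t :: real
  have D: "(q has_vector_derivative kern \<zeta> (complex_of_real t)) (at t)" if "t > 0" for t
    by (rule has_vector_derivative_transform_within_open[OF prim_has_vector_derivative, where S = "{0<..}"])
       (use that in \<open>auto simp: q_def\<close>)
  have "((\<lambda>t. kern \<zeta> (complex_of_real t)) has_integral (q 1 - q 0)) {0..1}"
  proof (rule fundamental_theorem_of_calculus_interior)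
    show "continuous_on {0..1} q"
      unfolding continuous_on_def
    proof
      fix t :: real assume t: "t \<in> {0..1}"
      show "(q \<longlongrightarrow> q t) (at t within {0..1})"
      proof (cases "t = 0")
        case True
        have "((\<lambda>t. q t - l) \<longlongrightarrow> 0) (at_right 0)"
        proof (rule Lim_null_comparison)
          show "\<forall>\<^sub>F t in at_right 0. norm (q t - l) \<le> C * t powr a"
            using eventually_at_right_less[of 0] eventually_at_right_real[of 0 1]
            by (auto simp: q_def elim!: eventually_mono intro!: bound)
          show "((\<lambda>t. C * t powr a) \<longlongrightarrow> 0) (at_right 0)"
            using a by real_asymp
        qed
        thus ?thesis
          unfolding True by (subst at_within_Icc_at_right) (auto simp: q_def[of 0] LIM_zero_iff)
      next
        case False
        with t have "isCont q t" by (intro has_vector_derivative_continuous[OF D]) auto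
        thus ?thesis unfolding isCont_def by (rule tendsto_within_subset) simp
      qed
    qed
  qed (use D in auto)
  hence "((\<lambda>t. kern \<zeta> (complex_of_real t)) has_integral (prim \<zeta> 1 - l)) {0..1}"
    by (simp add: q_def)
  thus ?thesis using that l unfolding u_def[abs_def] by blast
qed

text \<open>For imaginary \<zeta> the exponential has norm 1, so the truncated integrands are
  dominated by a multiple of the integrable power \<open>t powr (Re z - k)\<close>.\<close>

lemma kern_integral_near_infinity:
  assumes "Re \<zeta> = 0"
  shows "(\<lambda>t. kern \<zeta> (complex_of_real t)) integrable_on {1..}"
    and "(\<lambda>n. prim \<zeta> (complex_of_real (real (Suc n))) - prim \<zeta> 1) \<longlonglongrightarrow>
      integral {1..} (\<lambda>t. kern \<zeta> (complex_of_real t))"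
proof -
  let ?f = "\<lambda>t. kern \<zeta> (complex_of_real t)"
  define h where "h t = exp (\<bar>Im z\<bar> * pi + 1) * t powr (Re z - k)" for t :: real
  have I: "((\<lambda>t. if t \<in> {1..real (Suc n)} then ?f t else 0) has_integral
      (prim \<zeta> (complex_of_real (real (Suc n))) - prim \<zeta> 1)) {1..}" for n
  proof (subst has_integral_restrict)
    have "(?f has_integral (prim \<zeta> (complex_of_real (real (Suc n))) - prim \<zeta> (complex_of_real 1))) {1..real (Suc n)}"
      by (intro fundamental_theorem_of_calculus prim_has_vector_derivative) auto
    thus "(?f has_integral (prim \<zeta> (complex_of_real (real (Suc n))) - prim \<zeta> 1)) {1..real (Suc n)}"
      by simp
  qed auto
  have h: "h integrable_on {1..}"
    unfolding h_def using has_integral_powr_to_inf[of "Re z - k" 1] Re_z_lt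
    by (intro integrable_on_mult_right) (auto simp: integrable_on_def)
  have le: "norm (if t \<in> {1..real (Suc n)} then ?f t else 0) \<le> h t" if "t \<in> {1..}" for n t
  proof -
    have "norm (?f t) \<le> exp (\<bar>Im z\<bar> * pi + 1) * norm (complex_of_real t) powr (Re z - k) * 1"
      unfolding kern_def norm_mult using that assms
      by (intro mult_mono norm_osc_le) auto
    thus ?thesis using that by (auto simp: h_def)
  qed
  have conv: "(\<lambda>n. if t \<in> {1..real (Suc n)} then ?f t else 0) \<longlonglongrightarrow> ?f t" if "t \<in> {1..}" for t
  proof (rule tendsto_eventually)
    have "\<forall>\<^sub>F n in sequentially. t \<le> real n"
      using filterlim_real_sequentially by (simp add: filterlim_at_top)
    thus "\<forall>\<^sub>F n in sequentially. (if t \<in> {1..real (Suc n)} then ?f t else 0) = ?f t"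
      by eventually_elim (use that in auto)
  qed
  note dom = dominated_convergence[of "\<lambda>n t. if t \<in> {1..real (Suc n)} then ?f t else 0" "{1..}" h ?f,
      OF has_integral_integrable[OF I] h le conv]
  show "?f integrable_on {1..}" by (rule dom(1))
  show "(\<lambda>n. prim \<zeta> (complex_of_real (real (Suc n))) - prim \<zeta> 1) \<longlonglongrightarrow> integral {1..} ?f"
    using dom(2) by (simp only: integral_unique[OF I])
qed

lemma kern_has_improper_integral:
  assumes "Re \<zeta> = 0"
  obtains L where "((\<lambda>t. kern \<zeta> (complex_of_real t)) has_integral L) {0<..}"
    and "(\<lambda>n. prim \<zeta> (complex_of_real (real (Suc n))) - prim \<zeta> (complex_of_real (1 / real (Suc n)))) \<longlonglongrightarrow> L"
proof -
  let ?f = "\<lambda>t. kern \<zeta> (complex_of_real t)"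
  obtain l where l: "(?f has_integral (prim \<zeta> 1 - l)) {0..1}"
    "(\<lambda>n. prim \<zeta> (complex_of_real (1 / real (Suc n)))) \<longlonglongrightarrow> l"
    by (rule kern_has_integral_near_0)
  note inf = kern_integral_near_infinity[OF assms]
  let ?L = "(prim \<zeta> 1 - l) + integral {1..} ?f"
  have "(?f has_integral ?L) ({0..1} \<union> {1..})"
    by (intro has_integral_Un l(1) integrable_integral inf(1)) auto
  also have "{0..1} \<union> {1..} = {0::real..}" by auto
  finally have "(?f has_integral ?L) {0<..}"
  proof (rule has_integral_spike_set_eq[THEN iffD1, rotated 2])
    show "negligible {x \<in> {0..} - {0<..}. ?f x \<noteq> 0}"
      by (rule negligible_subset[OF negligible_sing[of 0]]) auto
    show "negligible {x \<in> {0<..} - {0..}. ?f x \<noteq> 0}"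
      by (rule negligible_subset[OF negligible_sing[of 0]]) auto
  qed
  moreover have "(\<lambda>n. prim \<zeta> (complex_of_real (real (Suc n))) - prim \<zeta> (complex_of_real (1 / real (Suc n)))) \<longlonglongrightarrow> ?L"
    using tendsto_add[OF inf(2) tendsto_diff[OF tendsto_const[of "prim \<zeta> 1"] l(2)]]
    by (simp add: algebra_simps)
  ultimately show ?thesis by (rule that)
qed

section \<open>Turning the ray back to the positive axis\<close>

text \<open>On the segment joining the end points of the two paths the exponential has norm at most
  1. The integrand is of order \<open>n powr e\<close> with \<open>e < - 1\<close> and the length of
  order \<open>n\<close>, so the product vanishes.\<close>

lemma prim_diff_segment_tendsto_0:
  assumes c: "c = \<i> \<or> c = - \<i>" and x: "x \<ge> 0"
  shows "(\<lambda>n. prim (c * of_real x) (complex_of_real (real n)) - prim (c * of_real x) (1 - c * of_real (real n)))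
    \<longlonglongrightarrow> 0"
proof (rule Lim_null_comparison)
  define B e where "B = exp (\<bar>Im z\<bar> * pi + 1)" and "e = Re z - k"
  have e: "e < - 1" using Re_z_lt by (simp add: e_def)
  let ?\<zeta> = "c * complex_of_real x"
  show "\<forall>\<^sub>F n in sequentially. norm (prim ?\<zeta> (complex_of_real (real n)) - prim ?\<zeta> (1 - c * of_real (real n)))
     \<le> B * (real n / 2) powr e * (2 * real n)"
    \<comment> \<open>From \<open>n = 2\<close> on, the lower bound \<open>n / 2\<close> for
      \<open>norm t\<close> is at least 1, as \<open>norm_osc_le\<close> requires.\<close>
    using eventually_ge_at_top[of 2]
  proof eventually_elim
    case (elim n)
    define R where "R = real n"
    have R: "R \<ge> 2" using elim by (simp add: R_def)
    let ?a = "1 - c * complex_of_real R" and ?b = "complex_of_real R"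
    have ab: "Re ?a > 0" "Re ?b > 0"
      using R ray_bounds(1)[OF c, of R] by auto
    have "norm (prim ?\<zeta> ?b - prim ?\<zeta> ?a) \<le> B * (R / 2) powr e * norm (?b - ?a)"
    proof (rule has_contour_integral_bound_linepath[OF kern_has_contour_integral[OF ab]])
      fix t assume "t \<in> closed_segment ?a ?b"
      then obtain u where u: "0 \<le> u" "u \<le> 1" and t: "t = (1 - u) *\<^sub>R ?a + u *\<^sub>R ?b"
        unfolding closed_segment_def by blast
      have Re_t: "Re t = (1 - u) + u * R" and Im_t: "\<bar>Im t\<bar> = (1 - u) * R"
        and Re_ct: "Re (c * t) = (1 - u) * R"
        using c u R by (auto simp: t algebra_simps abs_mult)
      \<comment> \<open>One of the two summands is then at least \<open>R / 2\<close>.\<close>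
      have "R \<le> Re t + \<bar>Im t\<bar>"
        using u unfolding Re_t Im_t by (simp add: algebra_simps)
      hence t2: "norm t \<ge> R / 2"
        using abs_Re_le_cmod[of t] abs_Im_le_cmod[of t] by linarith
      have "norm (osc t) \<le> B * norm t powr e"
        unfolding B_def e_def by (rule norm_osc_le) (use t2 R in linarith)
      also have "\<dots> \<le> B * (R / 2) powr e"
        using t2 R e by (intro mult_left_mono powr_mono2') (auto simp: B_def)
      finally have o: "norm (osc t) \<le> B * (R / 2) powr e" .
      have "0 \<le> x * Re (c * t)"
        unfolding Re_ct using x u R by simp
      also have "\<dots> = Re (?\<zeta> * t)"
        by (simp add: algebra_simps)
      finally have "norm (exp (- ?\<zeta> * t)) \<le> 1"
        unfolding norm_exp_eq_Re by simp
      with o have "norm (osc t) * norm (exp (- ?\<zeta> * t)) \<le> B * (R / 2) powr e * 1"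
        by (intro mult_mono) (auto simp: B_def)
      thus "norm (kern ?\<zeta> t) \<le> B * (R / 2) powr e"
        unfolding kern_def by (simp add: norm_mult)
    qed (simp add: B_def)
    also have "norm (?b - ?a) \<le> 2 * R"
    proof -
      have "?b - ?a = of_real (R - 1) + c * of_real R" by simp
      also have "norm \<dots> \<le> norm (complex_of_real (R - 1)) + norm (c * complex_of_real R)"
        by (rule norm_triangle_ineq)
      also have "\<dots> \<le> 2 * R"
        using c R by (auto simp: norm_mult simp del: of_real_diff)
      finally show ?thesis .
    qed
    finally show ?case
      by (simp add: R_def B_def mult_left_mono)
  qed
  show "(\<lambda>n. B * (real n / 2) powr e * (2 * real n)) \<longlonglongrightarrow> 0"
    using e by real_asymp
qed

text \<open>The truncations of both integrals are differences of the same primitive with the same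
  lower end point. Their upper end points differ by the segment whose contribution vanishes.\<close>

lemma kern_has_integral_rotated:
  assumes c: "c = \<i> \<or> c = - \<i>" and x: "x > 0"
  shows "((\<lambda>t. kern (c * of_real x) (complex_of_real t)) has_integral rotated c (c * of_real x)) {0<..}"
proof -
  let ?\<zeta> = "c * complex_of_real x"
  have \<zeta>: "Re ?\<zeta> = 0" "Re (?\<zeta> * c) < 0" using c x by auto
  obtain L where L: "((\<lambda>t. kern ?\<zeta> (complex_of_real t)) has_integral L) {0<..}"
    "(\<lambda>n. prim ?\<zeta> (complex_of_real (real (Suc n))) - prim ?\<zeta> (complex_of_real (1 / real (Suc n)))) \<longlonglongrightarrow> L"
    using kern_has_improper_integral[OF \<zeta>(1)] by blast
  have "(\<lambda>n. approx c (Suc n) ?\<zeta>) \<longlonglongrightarrow> L"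
    using tendsto_diff[OF L(2) LIMSEQ_Suc[OF prim_diff_segment_tendsto_0[OF c, of x]]] x
    by (simp add: approx_def)
  moreover have "(\<lambda>n. approx c (Suc n) ?\<zeta>) \<longlonglongrightarrow> rotated c ?\<zeta>"
    using LIMSEQ_Suc[OF higher_deriv_approx_tendsto[OF c \<zeta>(2), of 0]] by simp
  ultimately have "L = rotated c ?\<zeta>" by (rule LIMSEQ_unique)
  with L(1) show ?thesis by simp
qed

section \<open>The function \<open>H\<close> and its derivatives\<close>

lemma H_integrand_eq_kern:
  "H_integrand k z x = (\<lambda>t. (kern (\<i> * of_real x) (complex_of_real t) + kern (- \<i> * of_real x) (complex_of_real t)) / 2)"
proof
  fix t
  have e: "complex_of_real (cos (x * t)) =
      (exp (- (- \<i> * of_real x) * of_real t) + exp (- (\<i> * of_real x) * of_real t)) / 2"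
    by (simp add: cos_exp_eq mult.assoc flip: cos_of_real)
  have c: "complex_of_real (cos (1 / t ^ k)) = cos (1 / complex_of_real t ^ k)"
    by (simp flip: cos_of_real)
  have "p * ((u + v) / 2) * q = (p * q * v + p * q * u) / 2" for p q u v :: complex
    by (simp add: field_simps)
  thus "H_integrand k z x t =
      (kern (\<i> * of_real x) (complex_of_real t) + kern (- \<i> * of_real x) (complex_of_real t)) / 2"
    unfolding H_integrand_def kern_def osc_def e c .
qed

text \<open>Only \<open>Re \<zeta> = 0\<close> enters, not the rotation of the path, so
  \<open>x = 0\<close> is covered.\<close>

lemma H_integrand_integrable: "H_integrand k z x integrable_on {0<..}"
proof -
  have "(\<lambda>t. kern (c * of_real x) (complex_of_real t)) integrable_on {0<..}" if "c = \<i> \<or> c = - \<i>" for c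
  proof -
    have "Re (c * of_real x) = 0" using that by auto
    from kern_has_improper_integral[OF this] show ?thesis by (metis has_integral_integrable)
  qed
  from integrable_add[OF this this, of \<i> "- \<i>"] show ?thesis
    unfolding H_integrand_eq_kern by (intro integrable_on_divide) auto
qed

lemma H_eq_rotated:
  assumes "x > 0"
  shows "H k z x = (rotated \<i> (\<i> * of_real x) + rotated (- \<i>) (- \<i> * of_real x)) / 2"
  unfolding H_def H_integrand_eq_kern
  by (intro integral_unique has_integral_divide has_integral_add kern_has_integral_rotated assms) auto

text \<open>By the chain rule this is the \<open>n\<close>-th derivative in \<open>x\<close> of
  \<open>rotated c (c * of_real x)\<close> for \<open>x > 0\<close>.\<close>

definition rotated_deriv :: "complex \<Rightarrow> nat \<Rightarrow> real \<Rightarrow> complex" where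
  "rotated_deriv c n x = c ^ n * (deriv ^^ n) (rotated c) (c * of_real x)"

lemma rotated_deriv_has_vector_derivative:
  assumes c: "c = \<i> \<or> c = - \<i>" and x: "x > 0"
  shows "(rotated_deriv c n has_vector_derivative rotated_deriv c (Suc n) x) (at x)"
proof -
  let ?S = "{\<zeta>. Re (\<zeta> * c) < 0}"
  have S: "open ?S" by (intro open_Collect_less continuous_intros)
  have "c * of_real x \<in> ?S" using c x by auto
  note D = has_field_derivative_higher_deriv[OF rotated_holomorphic[OF c] S this, of n]
  have "((\<lambda>\<xi>. c ^ n * (deriv ^^ n) (rotated c) (c * \<xi>)) has_field_derivative
      c ^ n * ((deriv ^^ Suc n) (rotated c) (c * of_real x) * c)) (at (of_real x))"
    by (intro DERIV_cmult DERIV_chain2[where f = "(deriv ^^ n) (rotated c)" and g = "\<lambda>\<xi>. c * \<xi>", OF D]) (auto intro!: derivative_eq_intros)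
  from has_vector_derivative_real_field[OF this] show ?thesis
    by (simp add: rotated_deriv_def[abs_def] mult_ac)
qed

text \<open>A derivative at \<open>x\<close> depends only on values near \<open>x\<close>. The
  formula on the open half-line can therefore be differentiated again, and induction on the order
  applies.\<close>

lemma nth_deriv_H:
  "x > 0 \<Longrightarrow> nth_deriv n (H k z) x = (rotated_deriv \<i> n x + rotated_deriv (- \<i>) n x) / 2"
  "x > 0 \<Longrightarrow> (nth_deriv n (H k z) has_vector_derivative nth_deriv (Suc n) (H k z) x) (at x)"
proof -
  have D: "(nth_deriv n (H k z) has_vector_derivative
      (rotated_deriv \<i> (Suc n) x + rotated_deriv (- \<i>) (Suc n) x) / 2) (at x)"
    if "x > 0" "\<And>y. y > 0 \<Longrightarrow> nth_deriv n (H k z) y = (rotated_deriv \<i> n y + rotated_deriv (- \<i>) n y) / 2"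
    for n x
  proof (rule has_vector_derivative_transform_within_open)
    show "((\<lambda>y. (rotated_deriv \<i> n y + rotated_deriv (- \<i>) n y) / 2) has_vector_derivative
      (rotated_deriv \<i> (Suc n) x + rotated_deriv (- \<i>) (Suc n) x) / 2) (at x)"
      using that(1) by (intro has_vector_derivative_divide has_vector_derivative_add rotated_deriv_has_vector_derivative) auto
    show "open {0::real<..}" by simp
  qed (use that in auto)
  have step: "nth_deriv (Suc n) f x = vector_derivative (nth_deriv n f) (at x)" for n f x
    by (simp add: nth_deriv_def)
  have eq: "\<forall>x>0. nth_deriv n (H k z) x = (rotated_deriv \<i> n x + rotated_deriv (- \<i>) n x) / 2" for n
  proof (induction n)
    case 0
    show ?case by (simp add: nth_deriv_def rotated_deriv_def H_eq_rotated)
  next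
    case (Suc n)
    thus ?case unfolding step using vector_derivative_at[OF D[of _ n]] by blast
  qed
  thus "x > 0 \<Longrightarrow> nth_deriv n (H k z) x = (rotated_deriv \<i> n x + rotated_deriv (- \<i>) n x) / 2"
    by blast
  show "x > 0 \<Longrightarrow> (nth_deriv n (H k z) has_vector_derivative nth_deriv (Suc n) (H k z) x) (at x)"
    unfolding eq[rule_format, of x "Suc n"] using D eq by blast
qed

text \<open>With \<open>\<zeta> = c * x\<close> each power of \<open>x\<close> combines with as many
  factors \<open>c\<close> into a power of \<zeta>, leaving \<open>c ^ (2 * k) = (-1) ^ k\<close> in
  the first three terms. The whole is \<open>(-1) ^ k\<close> times the equation for
  \<open>rotated c\<close>.\<close>

lemma rotated_deriv_ode:
  assumes c: "c = \<i> \<or> c = - \<i>" and x: "x > 0"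
  shows "of_real (x ^ 2) * rotated_deriv c (2 * k + 2) x
        + (2 * z + of_nat k + 3) * of_real x * rotated_deriv c (2 * k + 1) x
        + (z + 1) * (z + of_nat k + 1) * rotated_deriv c (2 * k) x
        + (-1) ^ k * of_nat k ^ 2 * rotated_deriv c 0 x = 0" (is "?l = 0")
proof -
  have c2: "c ^ (2 * k) = (-1) ^ k" using c by (auto simp: power_mult)
  let ?\<zeta> = "c * complex_of_real x"
  have "Re (?\<zeta> * c) < 0" using c x by auto
  note ode = rotated_ode[OF c this]
  have "?l = (-1) ^ k * (?\<zeta>\<^sup>2 * (deriv ^^ (2 * k + 2)) (rotated c) ?\<zeta>
    + (2 * z + of_nat k + 3) * ?\<zeta> * (deriv ^^ (2 * k + 1)) (rotated c) ?\<zeta>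
    + (z + 1) * (z + of_nat k + 1) * (deriv ^^ (2 * k)) (rotated c) ?\<zeta>
    + of_nat k ^ 2 * rotated c ?\<zeta>)"
    unfolding rotated_deriv_def power_add c2 by (simp add: algebra_simps power_mult_distrib)
  thus ?thesis unfolding ode by simp
qed

end

theorem theorem4p2:
  fixes k :: nat and z :: complex and w :: "real \<Rightarrow> complex"
  assumes "-1 < Re z" and "Re z < real k - 1"
  defines "w \<equiv> H k z"
  shows "(\<forall>x\<ge>0. H_integrand k z x integrable_on {0<..}) \<and>
    (\<forall>x>0.
      (\<forall>n<2 * k + 2. nth_deriv n w differentiable (at x)) \<and>
      of_real (x ^ 2) * nth_deriv (2 * k + 2) w x
        + (2 * z + of_nat k + 3) * of_real x * nth_deriv (2 * k + 1) w x
        + (z + 1) * (z + of_nat k + 1) * nth_deriv (2 * k) w x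
        + (-1) ^ k * of_nat k ^ 2 * w x = 0)"
proof -
  interpret oscillatory_integral k z
    by unfold_locales (use assms in auto)
  have "of_real (x ^ 2) * nth_deriv (2 * k + 2) w x
        + (2 * z + of_nat k + 3) * of_real x * nth_deriv (2 * k + 1) w x
        + (z + 1) * (z + of_nat k + 1) * nth_deriv (2 * k) w x
        + (-1) ^ k * of_nat k ^ 2 * w x = 0" if x: "x > 0" for x
  proof -
    have w: "w x = (rotated_deriv \<i> 0 x + rotated_deriv (- \<i>) 0 x) / 2"
      using nth_deriv_H(1)[OF x, of 0] by (simp add: w_def nth_deriv_def)
    \<comment> \<open>By linearity the equation for the mean splits into those for
      \<open>c = \<i>\<close> and \<open>c = - \<i>\<close>.\<close>
    have *: "a * ((u1 + v1) / 2) + b * ((u2 + v2) / 2) + c * ((u3 + v3) / 2) + d * ((u4 + v4) / 2) =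
        ((a * u1 + b * u2 + c * u3 + d * u4) + (a * v1 + b * v2 + c * v3 + d * v4)) / 2"
      for a b c d u1 u2 u3 u4 v1 v2 v3 v4 :: complex
      by (simp add: field_simps)
    show ?thesis
      unfolding w unfolding w_def nth_deriv_H(1)[OF x] *
      using rotated_deriv_ode[OF _ x, of \<i>] rotated_deriv_ode[OF _ x, of "- \<i>"] by simp
  qed
  \<comment> \<open>This ensures that the iterated \<open>vector_derivative\<close> consists of
    genuine derivatives and not of unspecified values.\<close>
  moreover have "nth_deriv n w differentiable (at x)" if "x > 0" for n x
    using nth_deriv_H(2)[OF that] unfolding w_def by (rule differentiableI_vector)
  ultimately show ?thesis
    using H_integrand_integrable by blast
qed

end
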